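(* Let $L\ge1$ be an integer, $0\le r<1/2$, and $0<s_v<1/4-r/2$. In protocol P2 (the signature protocol based on shared secret classical keys, described in the context), suppose Alice and Charlie are honest and Bob is arbitrary. If the protocol was not aborted, so that Bob has not received at least $L(1/2-r)$ of the $L$ bits of Charlie's key ${\rm PrivKey}C_m$, then the probability that Bob produces, for a message $m$ that Alice has not signed, a declaration that Charlie accepts as a forwarded message satisfies $$p({\rm forge})\le \exp\!\left[-4\left(\frac14-\frac{s_v}{1-2r}\right)^2L(1-2r)\right].$$
   Context: Protocol P2 (for one fixed possible message $m$), all transmissions below in the distribution stage being over secure (secret and authenticated) classical channels. Distribution stage: Alice chooses independently and uniformly at random two keys ${\rm PrivKey}B_m,{\rm PrivKey}C_m\in\{0,1\}^L$ and sends the first to Bob and the second to Charlie (keys for different messages are independent). Each of Bob and Charlie, independently for each bit of his key, with probability $1/2$ sends that bit (with its position) to the other, and with probability $1/2$ does not. The protocol is aborted if the number of bits sent by either party to the other is less than $L(1/2-r)$ or more than $L(1/2+r)$. Messaging stage: a declaration consists of $m$ and two strings of $L$ bits, claimed to be ${\rm PrivKey}B_m$ and ${\rm PrivKey}C_m$. Charlie accepts a declaration forwarded by Bob if and only if (i) there is no mismatch between the declaration and the bits of ${\rm PrivKey}B_m$ that Bob sent him, and (ii) there are fewer than $s_vL$ positions of mismatch between the declaration and Charlie's key ${\rm PrivKey}C_m$. A dishonest Bob knows his own key, the bits (and positions) of ${\rm PrivKey}C_m$ that Charlie sent him, and nothing about the remaining bits of ${\rm PrivKey}C_m$. *)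

theory Defs
  imports "HOL-Probability.Probability"
begin

text \<open>
  Strings of \<open>L\<close> bits are functions on positions; only the values at positions \<open>i < L\<close> matter.
  A set of bits sent together with their positions is a partial map.
\<close>

type_synonym bits = "nat \<Rightarrow> bool"
type_synonym partial_bits = "nat \<rightharpoonup> bool"

definition key_pmf :: "nat \<Rightarrow> bits pmf" where
  "key_pmf L = Pi_pmf {..<L} False (\<lambda>_. pmf_of_set UNIV)"

definition forwarded_positions_pmf :: "nat \<Rightarrow> nat set pmf" where
  "forwarded_positions_pmf L =
     map_pmf (\<lambda>c. {i \<in> {..<L}. c i}) (Pi_pmf {..<L} False (\<lambda>_. bernoulli_pmf (1/2)))"

definition bits_at :: "bits \<Rightarrow> nat set \<Rightarrow> partial_bits" where
  "bits_at k S = (\<lambda>i. if i \<in> S then Some (k i) else None)"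

record 'm signed_msg =
  decl_msg :: 'm
  decl_B :: bits
  decl_C :: bits

record 'm run =
  PrivKeyB :: bits
  PrivKeyC :: bits
  to_Bob :: partial_bits
  to_Charlie :: partial_bits
  forwarded :: "'m signed_msg"

text \<open>
  An arbitrary Bob. For each possible view (his own key and the bits of Charlie's key, with
  positions, that Charlie sent him) he has an arbitrary joint distribution of what he sends to
  Charlie in the distribution stage and what he declares in the messaging stage. He may
  thus wait for Charlie's bits before sending, send any number of bits, and lie about their values.
  A Bob who proceeds in several steps, keeping a private memory, is a special case, as he receives
  nothing else that depends on Charlie's key: Alice has not signed the message, so
  nothing she declares about it reaches him, and anything he holds about other messages is
  independent of the two keys and can be regarded as part of his own randomness.
\<close>

type_synonym 'm bob_strategy =
  "bits \<Rightarrow> partial_bits \<Rightarrow> (partial_bits \<times> 'm signed_msg) pmf"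

text \<open>
  The protocol for one fixed possible message, with honest Alice and Charlie.
\<close>

definition run_pmf :: "nat \<Rightarrow> 'm bob_strategy \<Rightarrow> 'm run pmf" where
  "run_pmf L bob = do {
     kB \<leftarrow> key_pmf L;
     kC \<leftarrow> key_pmf L;
     S \<leftarrow> forwarded_positions_pmf L;
     (sent, d) \<leftarrow> bob kB (bits_at kC S);
     return_pmf \<lparr>PrivKeyB = kB, PrivKeyC = kC, to_Bob = bits_at kC S, to_Charlie = sent,
                 forwarded = d\<rparr>
   }"

definition num_sent :: "nat \<Rightarrow> partial_bits \<Rightarrow> nat" where
  "num_sent L t = card {i \<in> {..<L}. t i \<noteq> None}"

definition aborted :: "nat \<Rightarrow> real \<Rightarrow> 'm run \<Rightarrow> bool" where
  "aborted L r w \<longleftrightarrow>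
     (\<exists>t \<in> {to_Bob w, to_Charlie w}.
        real (num_sent L t) < real L * (1/2 - r) \<or> real (num_sent L t) > real L * (1/2 + r))"

text \<open>
  The declared string is compared with what Charlie received, which for a dishonest Bob
  need not agree with the key that Alice gave to Bob.
\<close>

definition charlie_accepts ::
  "nat \<Rightarrow> real \<Rightarrow> bits \<Rightarrow> partial_bits \<Rightarrow> 'm signed_msg \<Rightarrow> bool" where
  "charlie_accepts L s\<^sub>v kC received d \<longleftrightarrow>
     (\<forall>i<L. \<forall>b. received i = Some b \<longrightarrow> decl_B d i = b) \<and>
     real (card {i \<in> {..<L}. decl_C d i \<noteq> kC i}) < s\<^sub>v * real L"

definition bob_forges :: "nat \<Rightarrow> real \<Rightarrow> 'm \<Rightarrow> 'm run \<Rightarrow> bool" where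
  "bob_forges L s\<^sub>v m w \<longleftrightarrow>
     decl_msg (forwarded w) = m \<and>
     charlie_accepts L s\<^sub>v (PrivKeyC w) (to_Charlie w) (forwarded w)"

end

theory Submission
  imports Defs
begin

text \<open>
  Condition on everything Bob sees and does. The bits of Charlie's key that were withheld from
  Bob are then still uniform and independent, and whether the run is aborted is already decided.
  If it is not aborted, there are at least \<open>L (1/2 - r)\<close> such bits, and Bob's declaration mismatches
  each of them independently with probability \<open>1/2\<close>, so Hoeffding's inequality bounds the conditional
  probability of fewer than \<open>s\<^sub>v L\<close> mismatches. Averaging over the conditioning keeps the
  bound, since it has the form \<open>P(forge \<and> \<not> aborted) \<le> c P(\<not> aborted)\<close>.
\<close>

text \<open>An inequality of this form is linear in the distribution, so it survives mixing. A bound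
  on the conditional probabilities could not simply be averaged with the weights of
  \<open>M\<close>, since conditioning changes these weights.\<close>

lemma emeasure_bind_pmf_le_cmult:
  assumes "\<And>x. x \<in> set_pmf M \<Longrightarrow>
    emeasure (measure_pmf (f x)) A \<le> c * emeasure (measure_pmf (f x)) B"
  shows "emeasure (measure_pmf (bind_pmf M f)) A \<le> c * emeasure (measure_pmf (bind_pmf M f)) B"
proof -
  have "emeasure (measure_pmf (bind_pmf M f)) A \<le> (\<integral>\<^sup>+x. c * emeasure (measure_pmf (f x)) B \<partial>M)"
    unfolding emeasure_bind_pmf
    by (intro nn_integral_mono_AE) (use assms in \<open>auto simp: AE_measure_pmf_iff\<close>)
  also have "\<dots> = c * emeasure (measure_pmf (bind_pmf M f)) B"
    by (simp add: nn_integral_cmult)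
  finally show ?thesis .
qed

text \<open>Comparing a fair bit with a fixed bit gives a fair bit again, so whatever
  \<open>d\<close> is, the mismatches on \<open>T\<close> are independent fair coin tosses.\<close>

lemma map_pmf_card_mismatch:
  assumes "finite T"
  shows "map_pmf (\<lambda>g. card {i\<in>T. d i \<noteq> g i}) (Pi_pmf T False (\<lambda>_. pmf_of_set UNIV)) =
         binomial_pmf (card T) (1/2)"
proof -
  let ?U = "pmf_of_set UNIV :: bool pmf"
  have neq_unif: "bind_pmf ?U (\<lambda>b. return_pmf (x \<noteq> b)) = bernoulli_pmf (1/2)" for x :: bool
  proof -
    have "map_pmf (\<lambda>b. x \<noteq> b) ?U = pmf_of_set ((\<lambda>b. x \<noteq> b) ` UNIV)"
      by (rule map_pmf_of_set_inj) (auto simp: inj_on_def)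
    also have "(\<lambda>b. x \<noteq> b) ` UNIV = UNIV"
      by (auto simp: image_iff)
    finally show ?thesis
      by (simp add: map_pmf_def bernoulli_pmf_half_conv_pmf_of_set)
  qed
  have "Pi_pmf T False (\<lambda>_. bernoulli_pmf (1/2)) =
        Pi_pmf T False (\<lambda>i. bind_pmf ?U (\<lambda>b. return_pmf (d i \<noteq> b)))"
    by (simp only: neq_unif)
  also have "\<dots> = bind_pmf (Pi_pmf T False (\<lambda>_. ?U)) (\<lambda>g. Pi_pmf T False (\<lambda>i. return_pmf (d i \<noteq> g i)))"
    using assms by (rule Pi_pmf_bind)
  also have "\<dots> = map_pmf (\<lambda>g i. if i \<in> T then d i \<noteq> g i else False) (Pi_pmf T False (\<lambda>_. ?U))"
    using assms by (simp add: map_pmf_def Pi_pmf_return_pmf)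
  finally have mismatches: "Pi_pmf T False (\<lambda>_. bernoulli_pmf (1/2)) = \<dots>" .
  have "binomial_pmf (card T) (1/2) =
        map_pmf (\<lambda>f. card {i\<in>T. f i}) (Pi_pmf T False (\<lambda>_. bernoulli_pmf (1/2)))"
    using assms by (intro binomial_pmf_altdef') auto
  also have "\<dots> = map_pmf (\<lambda>g. card {i\<in>T. d i \<noteq> g i}) (Pi_pmf T False (\<lambda>_. ?U))"
    unfolding mismatches map_pmf_comp
    by (intro map_pmf_cong refl arg_cong[where f = card]) auto
  finally show ?thesis ..
qed

text \<open>This lets a lower bound \<open>n\<^sub>0\<close> on the number \<open>n\<close> of
  unknown bits replace \<open>n\<close> in Hoeffding's bound. After cross-multiplication the
  difference of the two sides factors, and both factors are nonnegative because \<open>n\<close> and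
  \<open>n\<^sub>0\<close> are at least \<open>2 * a\<close>.\<close>

lemma hoeffding_exponent_mono:
  fixes a n\<^sub>0 n :: real
  assumes "0 < a" "2 * a \<le> n\<^sub>0" "n\<^sub>0 \<le> n"
  shows "(n\<^sub>0 / 2 - a)\<^sup>2 / n\<^sub>0 \<le> (n / 2 - a)\<^sup>2 / n"
proof -
  have "(2 * a) * (2 * a) \<le> n * n\<^sub>0"
    using assms by (intro mult_mono) auto
  hence "0 \<le> (n - n\<^sub>0) * (n * n\<^sub>0 / 4 - a\<^sup>2)"
    using assms by (intro mult_nonneg_nonneg) (auto simp: power2_eq_square)
  also have "\<dots> = (n / 2 - a)\<^sup>2 * n\<^sub>0 - (n\<^sub>0 / 2 - a)\<^sup>2 * n"
    by (simp add: power2_eq_square field_simps)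
  finally show ?thesis
    using assms by (simp add: field_simps)
qed

lemma prob_few_mismatches_le:
  fixes a n\<^sub>0 :: real
  assumes "finite T" "0 < a" "2 * a \<le> n\<^sub>0" "n\<^sub>0 \<le> real (card T)"
  shows "measure_pmf.prob (Pi_pmf T False (\<lambda>_. pmf_of_set UNIV))
           {g. real (card {i\<in>T. d i \<noteq> g i}) < a} \<le> exp (- 2 * (n\<^sub>0 / 2 - a)\<^sup>2 / n\<^sub>0)"
proof -
  define n where "n = card T"
  interpret binomial_distribution n "1/2"
    by unfold_locales auto
  have n: "n > 0" "2 * a \<le> n"
    using assms by (auto simp: n_def intro!: Nat.gr0I)
  have "measure_pmf.prob (Pi_pmf T False (\<lambda>_. pmf_of_set UNIV)) {g. real (card {i\<in>T. d i \<noteq> g i}) < a}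
      = measure_pmf.prob (binomial_pmf n (1/2)) {x. real x < a}"
    unfolding n_def map_pmf_card_mismatch[OF assms(1), of d, symmetric] by simp
  \<comment> \<open>The threshold \<open>a\<close> is rewritten as the mean \<open>n / 2\<close>
    minus a deviation, which is nonnegative because \<open>2 * a \<le> n\<close>.\<close>
  also have "\<dots> \<le> measure_pmf.prob (binomial_pmf n (1/2)) {x. real x \<le> n * (1/2) - (n / 2 - a)}"
    by (intro measure_pmf.finite_measure_mono) auto
  also have "\<dots> \<le> exp (- 2 * (n / 2 - a)\<^sup>2 / n)"
    using n by (intro prob_le) auto
  also have "\<dots> \<le> exp (- 2 * (n\<^sub>0 / 2 - a)\<^sup>2 / n\<^sub>0)"
    using hoeffding_exponent_mono[of a n\<^sub>0 "real n"] assms by (simp add: n_def)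
  finally show ?thesis .
qed

lemma key_pmf_split:
  assumes "S \<subseteq> {..<L}"
  shows "key_pmf L =
    bind_pmf (Pi_pmf S False (\<lambda>_. pmf_of_set UNIV)) (\<lambda>f.
      map_pmf (\<lambda>g i. if i \<in> S then f i else g i) (Pi_pmf ({..<L} - S) False (\<lambda>_. pmf_of_set UNIV)))"
proof -
  have "key_pmf L = Pi_pmf (S \<union> ({..<L} - S)) False (\<lambda>_. pmf_of_set UNIV)"
    using assms by (simp add: key_pmf_def Un_absorb1)
  also have "\<dots> = map_pmf (\<lambda>(f, g) i. if i \<in> S then f i else g i)
      (pair_pmf (Pi_pmf S False (\<lambda>_. pmf_of_set UNIV)) (Pi_pmf ({..<L} - S) False (\<lambda>_. pmf_of_set UNIV)))"
    using assms by (intro Pi_pmf_union) (auto intro: finite_subset)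
  finally show ?thesis
    by (simp add: pair_pmf_def map_bind_pmf map_pmf_comp flip: map_pmf_def)
qed

text \<open>The positions are chosen independently of the keys, so they can be drawn first. Bob's
  strategy sees Charlie's key only on \<open>S\<close>, so the remaining bits \<open>g\<close> can
  be drawn after he has acted: this is the precise sense in which he knows nothing about
  them.\<close>

lemma run_pmf_withheld_last:
  "run_pmf L bob =
    bind_pmf (forwarded_positions_pmf L) (\<lambda>S.
    bind_pmf (key_pmf L) (\<lambda>kB.
    bind_pmf (Pi_pmf S False (\<lambda>_. pmf_of_set UNIV)) (\<lambda>f.
    bind_pmf (bob kB (bits_at f S)) (\<lambda>(sent, d).
    map_pmf (\<lambda>g. \<lparr>PrivKeyB = kB, PrivKeyC = (\<lambda>i. if i \<in> S then f i else g i),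
        to_Bob = bits_at f S, to_Charlie = sent, forwarded = d\<rparr>)
      (Pi_pmf ({..<L} - S) False (\<lambda>_. pmf_of_set UNIV))))))"
proof -
  let ?R = "\<lambda>kB kC S. bind_pmf (bob kB (bits_at kC S)) (\<lambda>(sent, d).
    return_pmf \<lparr>PrivKeyB = kB, PrivKeyC = kC, to_Bob = bits_at kC S, to_Charlie = sent, forwarded = d\<rparr>)"
  have "run_pmf L bob =
      bind_pmf (key_pmf L) (\<lambda>kB. bind_pmf (forwarded_positions_pmf L) (\<lambda>S.
        bind_pmf (key_pmf L) (\<lambda>kC. ?R kB kC S)))"
    unfolding run_pmf_def by (intro bind_pmf_cong refl bind_commute_pmf)
  also have "\<dots> = bind_pmf (forwarded_positions_pmf L) (\<lambda>S.
      bind_pmf (key_pmf L) (\<lambda>kB. bind_pmf (key_pmf L) (\<lambda>kC. ?R kB kC S)))"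
    by (rule bind_commute_pmf)
  also have "\<dots> = bind_pmf (forwarded_positions_pmf L) (\<lambda>S.
    bind_pmf (key_pmf L) (\<lambda>kB.
    bind_pmf (Pi_pmf S False (\<lambda>_. pmf_of_set UNIV)) (\<lambda>f.
    bind_pmf (bob kB (bits_at f S)) (\<lambda>(sent, d).
    map_pmf (\<lambda>g. \<lparr>PrivKeyB = kB, PrivKeyC = (\<lambda>i. if i \<in> S then f i else g i),
        to_Bob = bits_at f S, to_Charlie = sent, forwarded = d\<rparr>)
      (Pi_pmf ({..<L} - S) False (\<lambda>_. pmf_of_set UNIV))))))"
  proof (rule bind_pmf_cong[OF refl], rule bind_pmf_cong[OF refl], goal_cases)
    case (1 S kB)
    hence S: "S \<subseteq> {..<L}"
      by (auto simp: forwarded_positions_pmf_def)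
    \<comment> \<open>Bob's view does not involve \<open>g\<close>, so his move and the draw of
      \<open>g\<close> can be swapped below.\<close>
    have view: "bits_at (\<lambda>i. if i \<in> S then f i else g i) S = bits_at f S" for f g
      by (auto simp: bits_at_def)
    show ?case
      unfolding key_pmf_split[OF S] bind_assoc_pmf bind_map_pmf view
      by (rule bind_pmf_cong[OF refl], subst bind_commute_pmf)
         (simp add: map_pmf_def case_prod_unfold)
  qed
  finally show ?thesis .
qed

lemma num_sent_plus_withheld:
  "num_sent L t + card {i \<in> {..<L}. t i = None} = L"
proof -
  have "num_sent L t + card {i \<in> {..<L}. t i = None} =
        card ({i \<in> {..<L}. t i \<noteq> None} \<union> {i \<in> {..<L}. t i = None})"
    unfolding num_sent_def by (subst card_Un_disjoint) auto
  also have "{i \<in> {..<L}. t i \<noteq> None} \<union> {i \<in> {..<L}. t i = None} = {..<L}"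
    by auto
  finally show ?thesis by simp
qed

text \<open>At most \<open>L * (1/2 + r)\<close> of the \<open>L\<close> bits reached Bob; the
  others were withheld.\<close>

lemma not_aborted_imp_withheld:
  assumes "\<not> aborted L r w"
  shows "real L * (1/2 - r) \<le> real (card {i \<in> {..<L}. to_Bob w i = None})"
proof -
  have "real (num_sent L (to_Bob w)) \<le> real L * (1/2 + r)"
    using assms by (auto simp: aborted_def)
  moreover have "real (num_sent L (to_Bob w)) + real (card {i \<in> {..<L}. to_Bob w i = None}) = real L"
    using num_sent_plus_withheld[of L "to_Bob w"] by (metis of_nat_add)
  ultimately show ?thesis by (simp add: algebra_simps)
qed

text \<open>The constant is Hoeffding's bound for the guaranteed number
  \<open>real L * (1/2 - r)\<close> of withheld bits and the threshold
  \<open>s\<^sub>v * real L\<close>.\<close>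

lemma emeasure_forge_not_aborted_le:
  fixes m :: 'm and bob :: "'m bob_strategy"
  assumes "L \<ge> 1" "r < 1/2" "0 < s\<^sub>v" "s\<^sub>v < 1/4 - r/2"
  shows "emeasure (measure_pmf (run_pmf L bob)) {w. bob_forges L s\<^sub>v m w \<and> \<not> aborted L r w}
       \<le> ennreal (exp (- 2 * (real L * (1/2 - r) / 2 - s\<^sub>v * real L)\<^sup>2 / (real L * (1/2 - r))))
         * emeasure (measure_pmf (run_pmf L bob)) {w. \<not> aborted L r w}"
    (is "_ \<le> ennreal ?c * _")
proof -
  {
    \<comment> \<open>Everything is fixed here except the withheld bits; \<open>W g\<close> is the
      run in which they are \<open>g\<close>.\<close>
    fix S :: "nat set" and kB f :: bits and sent :: partial_bits and d :: "'m signed_msg"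
    define W where "W = (\<lambda>g. \<lparr>PrivKeyB = kB, PrivKeyC = (\<lambda>i. if i \<in> S then f i else g i),
      to_Bob = bits_at f S, to_Charlie = sent, forwarded = d\<rparr>)"
    define T where "T = {..<L} - S"
    define P where "P = Pi_pmf T False (\<lambda>_. pmf_of_set UNIV :: bool pmf)"
    have "emeasure (measure_pmf (map_pmf W P)) {w. bob_forges L s\<^sub>v m w \<and> \<not> aborted L r w}
       \<le> ennreal ?c * emeasure (measure_pmf (map_pmf W P)) {w. \<not> aborted L r w}"
    \<comment> \<open>The abort test looks only at the two transmissions, which do not depend on
      \<open>g\<close>, so a single sample value of \<open>g\<close> decides it for all.\<close>
    proof (cases "aborted L r (W (\<lambda>_. False))")
      case True
      hence "aborted L r (W g)" for g
        by (simp add: W_def aborted_def)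
      thus ?thesis by simp
    next
      case False
      hence not_aborted: "\<not> aborted L r (W g)" for g
        by (simp add: W_def aborted_def)
      have "{i \<in> {..<L}. to_Bob (W (\<lambda>_. False)) i = None} = T"
        by (auto simp: W_def T_def bits_at_def)
      hence T_large: "real L * (1/2 - r) \<le> real (card T)"
        using not_aborted_imp_withheld[OF False] by simp
      have "2 * s\<^sub>v * real L \<le> (1/2 - r) * real L"
        using assms by (intro mult_right_mono) auto
      hence few: "2 * (s\<^sub>v * real L) \<le> real L * (1/2 - r)"
        by (simp add: algebra_simps)
      \<comment> \<open>Bob may match every bit he was sent, but the mismatches inside
        \<open>T\<close> alone must already stay below the threshold.\<close>
      have mismatches_on_T: "real (card {i\<in>T. decl_C d i \<noteq> g i}) < s\<^sub>v * real L"
        if "bob_forges L s\<^sub>v m (W g)" for g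
      proof -
        have "card {i\<in>T. decl_C d i \<noteq> g i} \<le>
              card {i \<in> {..<L}. decl_C d i \<noteq> PrivKeyC (W g) i}"
          by (intro card_mono) (auto simp: T_def W_def)
        thus ?thesis
          using that by (simp add: bob_forges_def charlie_accepts_def W_def)
      qed
      have "measure_pmf.prob P {g. bob_forges L s\<^sub>v m (W g)} \<le>
            measure_pmf.prob P {g. real (card {i\<in>T. decl_C d i \<noteq> g i}) < s\<^sub>v * real L}"
        by (intro measure_pmf.finite_measure_mono) (auto dest: mismatches_on_T)
      also have "\<dots> \<le> ?c"
        unfolding P_def
        by (rule prob_few_mismatches_le) (use assms few T_large in \<open>auto simp: T_def\<close>)
      \<comment> \<open>No value of \<open>g\<close> leads to an abort, so the event on the right
        has probability 1.\<close>
      finally show ?thesis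
        using not_aborted by (simp add: measure_pmf.emeasure_eq_measure vimage_def)
    qed
  }
  note withheld_uniform = this
  show ?thesis
    unfolding run_pmf_withheld_last
    by (intro emeasure_bind_pmf_le_cmult, unfold case_prod_unfold, rule withheld_uniform)
qed

theorem mainTheorem4:
  fixes L :: nat and r s\<^sub>v :: real and m :: 'm and bob :: "'m bob_strategy"
  assumes "L \<ge> 1"
    and "0 \<le> r" and "r < 1/2"
    and "0 < s\<^sub>v" and "s\<^sub>v < 1/4 - r/2"
  shows "(\<forall>w \<in> set_pmf (run_pmf L bob). \<not> aborted L r w \<longrightarrow>
            real (card {i \<in> {..<L}. to_Bob w i = None}) \<ge> real L * (1/2 - r)) \<and>
         \<P>(w in measure_pmf (run_pmf L bob). bob_forges L s\<^sub>v m w \<bar> \<not> aborted L r w)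
           \<le> exp (- 4 * (1/4 - s\<^sub>v / (1 - 2 * r))\<^sup>2 * real L * (1 - 2 * r))"
proof (intro conjI ballI impI not_aborted_imp_withheld)
  let ?M = "measure_pmf (run_pmf L bob)"
  let ?c = "exp (- 4 * (1/4 - s\<^sub>v / (1 - 2 * r))\<^sup>2 * real L * (1 - 2 * r))"
  \<comment> \<open>In terms of \<open>q > 0\<close> the guaranteed number of withheld bits is
    \<open>L * q / 2\<close>, and the two exponents agree by clearing denominators.\<close>
  define q where "q = 1 - 2 * r"
  have "q > 0" and r_eq: "r = (1 - q) / 2"
    using assms by (auto simp: q_def)
  hence "- 2 * (real L * (1/2 - r) / 2 - s\<^sub>v * real L)\<^sup>2 / (real L * (1/2 - r)) =
        - 4 * (1/4 - s\<^sub>v / (1 - 2 * r))\<^sup>2 * real L * (1 - 2 * r)"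
    using assms(1) unfolding r_eq by (simp add: field_simps power2_eq_square)
  hence "emeasure ?M {w. bob_forges L s\<^sub>v m w \<and> \<not> aborted L r w}
       \<le> ennreal ?c * emeasure ?M {w. \<not> aborted L r w}"
    using emeasure_forge_not_aborted_le[OF assms(1,3,4,5), of bob m] by simp
  hence "measure ?M {w. bob_forges L s\<^sub>v m w \<and> \<not> aborted L r w}
       \<le> ?c * measure ?M {w. \<not> aborted L r w}"
    by (simp add: measure_pmf.emeasure_eq_measure flip: ennreal_mult)
  \<comment> \<open>If Bob makes every run abort, the conditional probability is
    \<open>0 / 0\<close>, which is \<open>0\<close> by convention; otherwise the inequality is
    divided by a positive number.\<close>
  thus "\<P>(w in ?M. bob_forges L s\<^sub>v m w \<bar> \<not> aborted L r w) \<le> ?c"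
    by (cases "measure ?M {w. \<not> aborted L r w} = 0")
       (simp_all add: cond_prob_def pos_divide_le_eq zero_less_measure_iff)
qed

end
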